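(* Let $F$ be a connected graph with $\ell$ vertices. If $F$ has a pendant sparkler subgraph, then $W'(F)\ge \ell-\mathrm{sp}(F)-3$.
   Context: Graphs are finite and simple. For integers $q\ge3$ and $p\ge1$, the sparkler graph $S_{q,p}$ consists of a star $K_{1,q-1}$ with center $c$ and a path $v_1v_2\dots v_p$ together with the edge $cv_1$; its tail end vertex is $v_p$ (so $S_{q,1}\cong K_{1,q}$ with tail end vertex a leaf). For $p=0$, $S_{q,0}$ is the star $K_{1,q-1}$ and its tail end vertex is the center. For a vertex $v$ of a connected graph $F$, a $v$-branch of $F$ is the subgraph of $F$ induced by the vertex set of a connected component of $F- v$ together with $v$. A $v$-branch $S$ is a pendant sparkler subgraph $S_{q,p}$ of $F$ (with $q\ge3$, $p\ge0$) if $S$ is isomorphic to $S_{q,p}$ via an isomorphism sending $v$ to the tail end vertex, and $v$ has degree at least $3$ or exactly $1$ in $F$. If $F$ has a pendant sparkler subgraph, $\mathrm{sp}(F)$ denotes the maximum $p$ such that $F$ has a pendant sparkler subgraph $S_{q,p}$ for some $q\ge3$. First-order sentences are over the vocabulary $\{\sim,=\}$. A sentence $\Phi$ defines a class $\mathcal C$ asymptotically over connected graphs if there is $N$ such that for every connected graph $G$ with at least $N$ vertices, $G\models\Phi$ iff $G\in\mathcal C$. $W'(F)$ is the minimum number of distinct variables in a sentence defining, asymptotically over connected graphs, the class of graphs containing a (not necessarily induced) subgraph isomorphic to $F$. *)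

theory Defs
  imports "Graph_Theory.Graph_Theory"
begin

text \<open>
  Finite simple graphs are represented by \<^const>\<open>pair_graph\<close>, i.e. finite loopless symmetric digraphs
  without parallel arcs; an undirected edge is a pair of opposite arcs.
\<close>

subsection \<open>Pendant sparklers\<close>

datatype sparkler_vertex = Center | Leaf nat | Path nat

definition sparkler :: "nat \<Rightarrow> nat \<Rightarrow> sparkler_vertex pair_pre_digraph" where
  "sparkler q p =
    (let A = {(Center, Leaf i) | i. i \<in> {1..q - 1}}
           \<union> {(Center, Path i) | i. i = 1 \<and> i \<le> p}
           \<union> {(Path i, Path (i + 1)) | i. 1 \<le> i \<and> i + 1 \<le> p}
     in \<lparr> pverts = {Center} \<union> Leaf ` {1..q - 1} \<union> Path ` {1..p}, parcs = A \<union> A\<inverse> \<rparr>)"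

definition tail_end :: "nat \<Rightarrow> sparkler_vertex" where
  "tail_end p = (if p = 0 then Center else Path p)"

text \<open>On symmetric digraphs \<^const>\<open>pre_digraph.sccs_verts\<close> gives the vertex sets of the connected
  components.\<close>

definition branches :: "'a pair_pre_digraph \<Rightarrow> 'a \<Rightarrow> ('a, 'a \<times> 'a) pre_digraph set" where
  "branches F v =
    {F \<restriction> (insert v C) | C. C \<in> pre_digraph.sccs_verts (pre_digraph.del_vert (with_proj F) v)}"

text \<open>The out-degree of a vertex of a symmetric loopless digraph is its number of neighbours.\<close>

definition pendant_sparkler ::
    "'a pair_pre_digraph \<Rightarrow> 'a \<Rightarrow> ('a, 'a \<times> 'a) pre_digraph \<Rightarrow> nat \<Rightarrow> nat \<Rightarrow> bool" where
  "pendant_sparkler F v S q p \<longleftrightarrow>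
     3 \<le> q \<and> v \<in> pverts F \<and> S \<in> branches F v \<and>
     (\<exists>hom. pre_digraph.digraph_isomorphism S hom \<and> app_iso hom S = with_proj (sparkler q p) \<and>
            iso_verts hom v = tail_end p) \<and>
     (3 \<le> out_degree F v \<or> out_degree F v = 1)"

definition has_pendant_sparkler :: "'a pair_pre_digraph \<Rightarrow> bool" where
  "has_pendant_sparkler F \<longleftrightarrow> (\<exists>v S q p. pendant_sparkler F v S q p)"

definition sp :: "'a pair_pre_digraph \<Rightarrow> nat" where
  "sp F = Max {p. \<exists>v S q. pendant_sparkler F v S q p}"

subsection \<open>First-order logic of graphs\<close>

datatype fo =
    Eq nat nat
  | Adj nat nat
  | Neg fo
  | Conj fo fo
  | Disj fo fo
  | Exists nat fo
  | Forall nat fo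

primrec vars :: "fo \<Rightarrow> nat set" where
  "vars (Eq x y) = {x, y}"
| "vars (Adj x y) = {x, y}"
| "vars (Neg \<phi>) = vars \<phi>"
| "vars (Conj \<phi> \<psi>) = vars \<phi> \<union> vars \<psi>"
| "vars (Disj \<phi> \<psi>) = vars \<phi> \<union> vars \<psi>"
| "vars (Exists x \<phi>) = insert x (vars \<phi>)"
| "vars (Forall x \<phi>) = insert x (vars \<phi>)"

primrec free_vars :: "fo \<Rightarrow> nat set" where
  "free_vars (Eq x y) = {x, y}"
| "free_vars (Adj x y) = {x, y}"
| "free_vars (Neg \<phi>) = free_vars \<phi>"
| "free_vars (Conj \<phi> \<psi>) = free_vars \<phi> \<union> free_vars \<psi>"
| "free_vars (Disj \<phi> \<psi>) = free_vars \<phi> \<union> free_vars \<psi>"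
| "free_vars (Exists x \<phi>) = free_vars \<phi> - {x}"
| "free_vars (Forall x \<phi>) = free_vars \<phi> - {x}"

definition sentence :: "fo \<Rightarrow> bool" where
  "sentence \<phi> \<longleftrightarrow> free_vars \<phi> = {}"

primrec sat :: "'a pair_pre_digraph \<Rightarrow> (nat \<Rightarrow> 'a) \<Rightarrow> fo \<Rightarrow> bool" where
  "sat G s (Eq x y) \<longleftrightarrow> s x = s y"
| "sat G s (Adj x y) \<longleftrightarrow> (s x, s y) \<in> parcs G"
| "sat G s (Neg \<phi>) \<longleftrightarrow> \<not> sat G s \<phi>"
| "sat G s (Conj \<phi> \<psi>) \<longleftrightarrow> sat G s \<phi> \<and> sat G s \<psi>"
| "sat G s (Disj \<phi> \<psi>) \<longleftrightarrow> sat G s \<phi> \<or> sat G s \<psi>"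
| "sat G s (Exists x \<phi>) \<longleftrightarrow> (\<exists>a \<in> pverts G. sat G (s(x := a)) \<phi>)"
| "sat G s (Forall x \<phi>) \<longleftrightarrow> (\<forall>a \<in> pverts G. sat G (s(x := a)) \<phi>)"

definition models :: "'a pair_pre_digraph \<Rightarrow> fo \<Rightarrow> bool" where
  "models G \<phi> \<longleftrightarrow> (\<forall>s. range s \<subseteq> pverts G \<longrightarrow> sat G s \<phi>)"

text \<open>Every finite graph is isomorphic to one with vertices in \<^typ>\<open>nat\<close>, so classes of graphs are
  represented by their members over \<^typ>\<open>nat\<close>.\<close>

definition defines_asymptotically :: "fo \<Rightarrow> nat pair_pre_digraph set \<Rightarrow> bool" where
  "defines_asymptotically \<phi> \<C> \<longleftrightarrow>
    (\<exists>N. \<forall>G. pair_graph G \<and> Digraph_Component.connected G \<and> N \<le> card (pverts G) \<longrightarrow>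
      (models G \<phi> \<longleftrightarrow> G \<in> \<C>))"

definition graphs_containing :: "'a pair_pre_digraph \<Rightarrow> nat pair_pre_digraph set" where
  "graphs_containing F =
    {G. pair_graph G \<and> (\<exists>H. pair_graph H \<and> subgraph H G \<and> digraph_iso F H)}"

definition asymptotic_width :: "'a pair_pre_digraph \<Rightarrow> nat" where
  "asymptotic_width F =
    (LEAST k. \<exists>\<phi>. sentence \<phi> \<and> defines_asymptotically \<phi> (graphs_containing F) \<and> card (vars \<phi>) = k)"

end

theory Submission
  imports Defs
begin

text \<open>
  Attach a clique to one end of a path on \<open>p + 1\<close> vertices and \<open>n\<close> leaves to the other end. Apart
  from the path vertex it contains, the clique consists of twins, so a sentence with \<open>k\<close> variables
  cannot tell \<open>k\<close> twins from more of them; since a large clique contains \<open>F\<close>, a sentence defining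
  containment of \<open>F\<close> forces \<open>F\<close> into every large host with only \<open>k\<close> twins.

  A long path without leaves shows that all degrees of \<open>F\<close> are at most \<open>k + 1\<close>. Now let
  \<open>p = sp(F) + 1\<close>, let \<open>n\<close> be large, and suppose \<open>\<ell> > k + sp(F) + 3\<close>. Then a copy of \<open>F\<close> uses at
  least two leaves. If it avoids the far end of the path, then almost all of its vertices are leaves,
  and the centre has degree above \<open>k + 1\<close>. Otherwise it uses the whole path, and following the tail
  beyond the path until the degree differs from 2 exhibits a pendant sparkler with a tail longer than
  \<open>sp(F)\<close>.
\<close>

subsection \<open>Subgraph containment and connectedness\<close>

lemma out_degree_pair: "out_degree (with_proj G) v = card {u. (v, u) \<in> parcs G}"
proof -
  have "out_arcs (with_proj G) v = Pair v ` {u. (v, u) \<in> parcs G}"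
    by (auto simp: out_arcs_def)
  then show ?thesis
    by (simp add: out_degree_def card_image inj_on_def)
qed

lemma pair_graphI:
  assumes "finite (pverts G)" and "parcs G \<subseteq> pverts G \<times> pverts G"
    and "sym (parcs G)" and "irrefl (parcs G)"
  shows "pair_graph G"
proof -
  have "finite (parcs G)"
    using assms(1,2) by (meson finite_SigmaI finite_subset)
  then show ?thesis
    using assms by unfold_locales (auto simp: symmetric_def irrefl_def)
qed

text \<open>Arcs are pairs, so the arc part of an isomorphism is forced by its vertex part, and a
  copy of \<open>F\<close> amounts to an injective arc-preserving map. Conversely, the image of
  \<open>F\<close> under such a map is the required subgraph.\<close>

lemma graphs_containing_iff:
  assumes "pair_graph F" and "pair_graph G"
  shows "G \<in> graphs_containing F \<longleftrightarrow>
    (\<exists>f. inj_on f (pverts F) \<and> f ` pverts F \<subseteq> pverts G \<and>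
      (\<forall>u v. (u, v) \<in> parcs F \<longrightarrow> (f u, f v) \<in> parcs G))"
    (is "_ \<longleftrightarrow> ?R")
proof
  interpret F: pair_graph F by fact
  interpret G: pair_graph G by fact
  show ?R if "G \<in> graphs_containing F"
  proof -
    from that obtain H h where H: "subgraph (with_proj H) (with_proj G)"
      and h: "F.digraph_isomorphism h"
      and eq: "with_proj H = app_iso h (with_proj F)"
      unfolding graphs_containing_def digraph_iso_def by auto
    have verts: "pverts H = iso_verts h ` pverts F" and arcs: "parcs H = iso_arcs h ` parcs F"
      and ends: "iso_tail h = fst" "iso_head h = snd"
      using arg_cong[OF eq, of verts] arg_cong[OF eq, of arcs]
        arg_cong[OF eq, of tail] arg_cong[OF eq, of head] by auto
    have "iso_arcs h (u, v) = (iso_verts h u, iso_verts h v)" if "(u, v) \<in> parcs F" for u v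
      using h that ends unfolding F.digraph_isomorphism_def by (force simp: prod_eq_iff)
    then have "(iso_verts h u, iso_verts h v) \<in> parcs H" if "(u, v) \<in> parcs F" for u v
      using that arcs by force
    moreover have "pverts H \<subseteq> pverts G" "parcs H \<subseteq> parcs G"
      using H by (auto simp: subgraph_def)
    moreover have "inj_on (iso_verts h) (pverts F)"
      using h unfolding F.digraph_isomorphism_def by simp
    ultimately show ?R using verts by blast
  qed
  show "G \<in> graphs_containing F" if ?R
  proof -
    from that obtain f where f: "inj_on f (pverts F)" "f ` pverts F \<subseteq> pverts G"
      and arcs: "\<And>u v. (u, v) \<in> parcs F \<Longrightarrow> (f u, f v) \<in> parcs G" by blast
    define H where "H = \<lparr> pverts = f ` pverts F, parcs = map_prod f f ` parcs F \<rparr>"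
    define h where "h = \<lparr> iso_verts = f, iso_arcs = map_prod f f,
      iso_head = (snd :: nat \<times> nat \<Rightarrow> nat), iso_tail = (fst :: nat \<times> nat \<Rightarrow> nat) \<rparr>"
    have sub: "parcs H \<subseteq> parcs G" using arcs by (auto simp: H_def)
    have "pair_graph H"
    proof (rule pair_graphI)
      show "finite (pverts H)" by (simp add: H_def)
      show "parcs H \<subseteq> pverts H \<times> pverts H"
        by (auto simp: H_def dest: F.in_arcsD1 F.in_arcsD2)
      show "sym (parcs H)"
        by (auto simp: H_def sym_def) (metis F.arcs_symmetric map_prod_imageI)
      show "irrefl (parcs H)"
        using sub G.no_loops' by (auto simp: irrefl_def)
    qed
    moreover have "subgraph (with_proj H) (with_proj G)"
      using sub f(2) \<open>pair_graph H\<close> \<open>pair_graph G\<close>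
      by (auto simp: subgraph_def H_def wf_digraph_wp_iff pair_graph_def pair_digraph_def
          pair_fin_digraph_def)
    moreover have "inj_on (map_prod f f) (parcs F)"
      by (rule inj_on_subset[OF map_prod_inj_on[OF f(1) f(1)]])
        (auto dest: F.in_arcsD1 F.in_arcsD2)
    then have "F.digraph_isomorphism h"
      unfolding F.digraph_isomorphism_def using f(1)
      by (auto simp: h_def wf_digraph_wp_iff F.pair_wf_digraph)
    moreover have "with_proj H = app_iso h (with_proj F)"
      by (simp add: with_proj_def H_def h_def app_iso_def)
    ultimately show ?thesis
      using \<open>pair_graph G\<close> unfolding graphs_containing_def digraph_iso_def by blast
  qed
qed

text \<open>A set that no arc leaves is closed under reachability. Later choices of \<open>A\<close>
  confine an embedded copy of \<open>F\<close> to a part of the host or force it across a particular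
  path edge.\<close>

lemma (in pair_graph) connected_crossing_arc:
  assumes "Digraph_Component.connected (with_proj G)"
    and "a \<in> A" and "a \<in> pverts G" and "b \<in> pverts G" and "b \<notin> A"
  shows "\<exists>x y. (x, y) \<in> parcs G \<and> x \<in> A \<and> y \<notin> A"
proof -
  have "strongly_connected (with_proj G)"
    using symmetric_connected_imp_strongly_connected[OF sym_arcs assms(1)] .
  then have "a \<rightarrow>\<^sup>*\<^bsub>with_proj G\<^esub> b"
    using assms(3,4) by (auto simp: strongly_connected_def)
  then have "b \<in> A" if "\<forall>x y. (x, y) \<in> parcs G \<and> x \<in> A \<longrightarrow> y \<in> A"
    by (induct rule: reachable_induct) (use that assms(2) in auto)
  then show ?thesis using assms(5) by blast
qed

lemma (in pair_graph) connectedI_reachable: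
  assumes "r \<in> pverts G" and "\<And>u. u \<in> pverts G \<Longrightarrow> u \<rightarrow>\<^sup>*\<^bsub>with_proj G\<^esub> r"
  shows "Digraph_Component.connected (with_proj G)"
proof (rule connectedI)
  show "pverts G \<noteq> {}" using assms(1) by auto
  fix u v assume "u \<in> pverts G" "v \<in> pverts G"
  then have "u \<rightarrow>\<^sup>*\<^bsub>with_proj G\<^esub> v"
    using assms(2) symmetric_reachable' reachable_trans by metis
  then show "u \<rightarrow>\<^sup>*\<^bsub>with_proj (mk_symmetric (with_proj G))\<^esub> v"
    by (rule reachable_mk_symmetricI)
qed

subsection \<open>Sentences defining subgraph containment\<close>

lemma sat_cong:
  assumes "\<And>x. x \<in> free_vars \<phi> \<Longrightarrow> s x = s' x"
  shows "sat G s \<phi> \<longleftrightarrow> sat G s' \<phi>"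
  using assms
proof (induction \<phi> arbitrary: s s')
  case (Eq x y)
  show ?case using Eq[of x] Eq[of y] by simp
next
  case (Adj x y)
  show ?case using Adj[of x] Adj[of y] by simp
next
  case (Neg \<phi>)
  show ?case using Neg.IH[OF Neg.prems] by simp
next
  case (Conj \<phi> \<psi>)
  show ?case using Conj.IH(1)[OF Conj.prems] Conj.IH(2)[OF Conj.prems] by simp
next
  case (Disj \<phi> \<psi>)
  show ?case using Disj.IH(1)[OF Disj.prems] Disj.IH(2)[OF Disj.prems] by simp
next
  case (Exists x \<phi>)
  have "sat G (s(x := a)) \<phi> \<longleftrightarrow> sat G (s'(x := a)) \<phi>" for a
    using Exists.prems by (intro Exists.IH) simp
  then show ?case by simp
next
  case (Forall x \<phi>)
  have "sat G (s(x := a)) \<phi> \<longleftrightarrow> sat G (s'(x := a)) \<phi>" for a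
    using Forall.prems by (intro Forall.IH) simp
  then show ?case by simp
qed

text \<open>A sentence ignores the assignment. The condition on \<open>s\<close> also makes the
  vertex set nonempty; on the empty graph \<open>models\<close> would hold vacuously.\<close>

lemma models_iff_sat:
  assumes "sentence \<phi>" and "range s \<subseteq> pverts G"
  shows "models G \<phi> \<longleftrightarrow> sat G s \<phi>"
proof -
  have "sat G s' \<phi> \<longleftrightarrow> sat G s \<phi>" for s'
    by (rule sat_cong) (use assms(1) in \<open>simp add: sentence_def\<close>)
  then show ?thesis using assms(2) unfolding models_def by blast
qed

lemma finite_vars: "finite (vars \<phi>)"
  by (induction \<phi>) auto

text \<open>Guarantees at least one twin in a host with as many twins as variables, as the degree
  bound requires.\<close>

lemma vars_nonempty: "vars \<phi> \<noteq> {}"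
  by (induction \<phi>) auto

lemma free_vars_foldr_Exists: "free_vars (foldr Exists xs \<phi>) = free_vars \<phi> - set xs"
  by (induction xs) auto

lemma sat_foldr_Exists:
  "sat G s (foldr Exists xs \<phi>) \<longleftrightarrow>
    (\<exists>s'. (\<forall>x. x \<notin> set xs \<longrightarrow> s' x = s x) \<and> s' ` set xs \<subseteq> pverts G \<and> sat G s' \<phi>)"
proof (induction xs arbitrary: s)
  case Nil
  have "s' = s" if "\<forall>x. s' x = s x" for s' using that by auto
  then show ?case by auto
next
  case (Cons x xs)
  show ?case
  proof
    assume "sat G s (foldr Exists (x # xs) \<phi>)"
    then obtain a s' where s': "a \<in> pverts G" "\<forall>y. y \<notin> set xs \<longrightarrow> s' y = (s(x := a)) y"
      "s' ` set xs \<subseteq> pverts G" "sat G s' \<phi>"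
      using Cons by auto
    \<comment> \<open>If \<open>x\<close> occurs again in \<open>xs\<close>, the inner quantifier
      overrides \<open>a\<close>, so both cases have to be checked.\<close>
    then have "s' x \<in> pverts G" by (cases "x \<in> set xs") auto
    with s' show "\<exists>s'. (\<forall>y. y \<notin> set (x # xs) \<longrightarrow> s' y = s y) \<and>
        s' ` set (x # xs) \<subseteq> pverts G \<and> sat G s' \<phi>"
      by (intro exI[of _ s']) auto
  next
    assume "\<exists>s'. (\<forall>y. y \<notin> set (x # xs) \<longrightarrow> s' y = s y) \<and>
        s' ` set (x # xs) \<subseteq> pverts G \<and> sat G s' \<phi>"
    then obtain s' where s': "\<forall>y. y \<notin> set (x # xs) \<longrightarrow> s' y = s y"
      "s' ` set (x # xs) \<subseteq> pverts G" "sat G s' \<phi>" by blast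
    then have "sat G (s(x := s' x)) (foldr Exists xs \<phi>)"
      unfolding Cons by (intro exI[of _ s']) auto
    then show "sat G s (foldr Exists (x # xs) \<phi>)" using s' by auto
  qed
qed

lemma sat_foldr_Conj:
  "sat G s (foldr Conj \<phi>s \<psi>) \<longleftrightarrow> (\<forall>\<phi>\<in>set \<phi>s. sat G s \<phi>) \<and> sat G s \<psi>"
  by (induction \<phi>s) auto

lemma free_vars_foldr_Conj:
  "free_vars (foldr Conj \<phi>s \<psi>) = \<Union>(free_vars ` set \<phi>s) \<union> free_vars \<psi>"
  by (induction \<phi>s) auto

text \<open>Needed because the \<open>LEAST\<close> in \<open>asymptotic_width\<close> says nothing
  unless some defining sentence exists. The witness quantifies one variable per vertex of
  \<open>F\<close> and lists the required adjacencies and inequalities.\<close>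

lemma sentence_defining_graphs_containing:
  fixes F :: "'a pair_pre_digraph"
  assumes "pair_graph F" and "pverts F \<noteq> {}"
  shows "\<exists>\<phi>. sentence \<phi> \<and> defines_asymptotically \<phi> (graphs_containing F)"
proof -
  interpret F: pair_graph F by fact
  define l where "l = card (pverts F)"
  obtain e where e: "bij_betw e {..<l} (pverts F)"
    using ex_bij_betw_nat_finite[OF F.pair_finite_verts] by (auto simp: l_def atLeast0LessThan)
  have "l > 0" using assms(2) by (simp add: l_def card_gt_0_iff)
  define ps where "ps = List.product [0..<l] [0..<l]"
  \<comment> \<open>Adjacent pairs need no inequality, since the graphs are loopless. The diagonal
    gets the trivial \<open>Eq i i\<close>; likewise \<open>Eq 0 0\<close> below is a true end of
    the conjunction, and its variable is quantified because \<open>l > 0\<close>.\<close>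
  define lit where "lit = (\<lambda>(i, j). if (e i, e j) \<in> parcs F then Adj i j
    else if i = j then Eq i i else Neg (Eq i j))"
  define \<psi> where "\<psi> = foldr Conj (map lit ps) (Eq 0 0)"
  define \<phi> where "\<phi> = foldr Exists [0..<l] \<psi>"
  have "free_vars \<psi> \<subseteq> {..<l}"
    using \<open>l > 0\<close> by (auto simp: \<psi>_def free_vars_foldr_Conj ps_def lit_def split: if_splits)
  then have sent: "sentence \<phi>"
    by (auto simp: sentence_def \<phi>_def free_vars_foldr_Exists)
  have \<psi>: "sat G s \<psi> \<longleftrightarrow> inj_on s {..<l} \<and>
      (\<forall>i<l. \<forall>j<l. (e i, e j) \<in> parcs F \<longrightarrow> (s i, s j) \<in> parcs G)"
    if "pair_graph G" for G :: "nat pair_pre_digraph" and s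
  proof -
    interpret G: pair_graph G by fact
    have "sat G s \<psi> \<longleftrightarrow> (\<forall>i<l. \<forall>j<l. sat G s (lit (i, j)))"
      by (auto simp: \<psi>_def sat_foldr_Conj ps_def)
    also have "\<dots> \<longleftrightarrow> (\<forall>i<l. \<forall>j<l. ((e i, e j) \<in> parcs F \<longrightarrow> (s i, s j) \<in> parcs G) \<and>
        (i \<noteq> j \<longrightarrow> s i \<noteq> s j))"
      by (intro all_cong) (use G.no_loops' in \<open>auto simp: lit_def\<close>)
    finally show ?thesis by (auto simp: inj_on_def)
  qed
  have "models G \<phi> \<longleftrightarrow> G \<in> graphs_containing F"
    if G: "pair_graph G" and ne: "pverts G \<noteq> {}" for G :: "nat pair_pre_digraph"
  proof -
    obtain a where a: "a \<in> pverts G" using ne by auto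
    have "models G \<phi> \<longleftrightarrow> sat G (\<lambda>_. a) \<phi>"
      by (rule models_iff_sat[OF sent]) (use a in auto)
    also have "\<dots> \<longleftrightarrow> G \<in> graphs_containing F"
      unfolding graphs_containing_iff[OF assms(1) G]
    proof
      assume "sat G (\<lambda>_. a) \<phi>"
      then obtain s where s: "s ` {..<l} \<subseteq> pverts G" "inj_on s {..<l}"
        "\<And>i j. i < l \<Longrightarrow> j < l \<Longrightarrow> (e i, e j) \<in> parcs F \<Longrightarrow> (s i, s j) \<in> parcs G"
        unfolding \<phi>_def sat_foldr_Exists \<psi>[OF G] by (auto simp: atLeast0LessThan)
      define g where "g = the_inv_into {..<l} e"
      have g: "bij_betw g (pverts F) {..<l}"
        unfolding g_def by (rule bij_betw_the_inv_into[OF e])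
      have eg: "e (g u) = u" if "u \<in> pverts F" for u
        using that e unfolding g_def bij_betw_def by (simp add: f_the_inv_into_f)
      have gl: "g u < l" if "u \<in> pverts F" for u
        using g that by (auto simp: bij_betw_def)
      have "inj_on (s \<circ> g) (pverts F)"
        using g s(2) by (auto simp: bij_betw_def intro: comp_inj_on)
      moreover have "(s \<circ> g) ` pverts F \<subseteq> pverts G"
        using gl s(1) by auto
      moreover have "((s \<circ> g) u, (s \<circ> g) v) \<in> parcs G" if "(u, v) \<in> parcs F" for u v
        using s(3)[of "g u" "g v"] that gl eg F.in_arcsD1[OF that] F.in_arcsD2[OF that] by simp
      ultimately show "\<exists>f. inj_on f (pverts F) \<and> f ` pverts F \<subseteq> pverts G \<and>
          (\<forall>u v. (u, v) \<in> parcs F \<longrightarrow> (f u, f v) \<in> parcs G)" by blast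
    next
      assume "\<exists>f. inj_on f (pverts F) \<and> f ` pverts F \<subseteq> pverts G \<and>
          (\<forall>u v. (u, v) \<in> parcs F \<longrightarrow> (f u, f v) \<in> parcs G)"
      then obtain f where f: "inj_on f (pverts F)" "f ` pverts F \<subseteq> pverts G"
        "\<And>u v. (u, v) \<in> parcs F \<Longrightarrow> (f u, f v) \<in> parcs G" by blast
      \<comment> \<open>Outside the quantified variables the assignment must keep the initial value
        \<open>a\<close>.\<close>
      define s where "s i = (if i < l then f (e i) else a)" for i
      have ein: "e i \<in> pverts F" if "i < l" for i
        using e that by (auto simp: bij_betw_def)
      have "inj_on s {..<l}"
        using e f(1) ein by (auto simp: s_def bij_betw_def inj_on_def)
      moreover have "s ` {..<l} \<subseteq> pverts G" using f(2) ein by (auto simp: s_def)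
      moreover have "(s i, s j) \<in> parcs G" if "i < l" "j < l" "(e i, e j) \<in> parcs F" for i j
        using that f(3) by (simp add: s_def)
      ultimately show "sat G (\<lambda>_. a) \<phi>"
        unfolding \<phi>_def sat_foldr_Exists \<psi>[OF G]
        by (intro exI[of _ s]) (auto simp: atLeast0LessThan s_def)
    qed
    finally show ?thesis .
  qed
  \<comment> \<open>Only the empty graph has to be excluded, so the threshold can be 1.\<close>
  then have "defines_asymptotically \<phi> (graphs_containing F)"
    unfolding defines_asymptotically_def by (metis card.empty not_one_le_zero)
  with sent show ?thesis by blast
qed

subsection \<open>Twins cannot be counted with few variables\<close>

text \<open>The winning invariant of Duplicator in the pebble game on two graphs that share the part \<open>R\<close>
  and differ in the sets \<open>T\<close>, \<open>T'\<close> of twins.\<close>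

definition agree :: "nat set \<Rightarrow> 'a set \<Rightarrow> 'a set \<Rightarrow> 'a set \<Rightarrow> (nat \<Rightarrow> 'a) \<Rightarrow> (nat \<Rightarrow> 'a) \<Rightarrow> bool" where
  "agree X R T T' s s' \<longleftrightarrow>
    (\<forall>x\<in>X. s x \<in> R \<and> s' x = s x \<or> s x \<in> T \<and> s' x \<in> T') \<and>
    (\<forall>x\<in>X. \<forall>y\<in>X. s x = s y \<longleftrightarrow> s' x = s' y)"

lemma agree_sym: "agree X R T T' s s' \<Longrightarrow> agree X R T' T s' s"
  unfolding agree_def by auto

text \<open>One round of the pebble game, with pebble \<open>x\<close> moved to \<open>a\<close>. A
  shared vertex is answered by itself and a twin already pebbled by its partner. A fresh twin is
  answered by an unpebbled one, which exists because the other pebbles occupy at most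
  \<open>card X - 1 < card T'\<close> vertices.\<close>

lemma agree_extend:
  assumes s: "agree X R T T' s s'" and "finite X" and "x \<in> X" and "card X \<le> card T'"
    and "R \<inter> T = {}" and "R \<inter> T' = {}" and a: "a \<in> R \<union> T"
  shows "\<exists>a'\<in>R \<union> T'. agree X R T T' (s(x := a)) (s'(x := a'))"
proof -
  have s1: "s y \<in> R \<and> s' y = s y \<or> s y \<in> T \<and> s' y \<in> T'" if "y \<in> X" for y
    using s that by (simp add: agree_def)
  have s2: "s y = s z \<longleftrightarrow> s' y = s' z" if "y \<in> X" "z \<in> X" for y z
    using s that by (simp add: agree_def)
  have "\<exists>a'. (a \<in> R \<and> a' = a \<or> a \<in> T \<and> a' \<in> T') \<and> (\<forall>y\<in>X - {x}. s y = a \<longleftrightarrow> s' y = a')"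
  proof -
    consider (R) "a \<in> R" | (old) y where "a \<in> T" "y \<in> X" "s y = a"
      | (new) "a \<in> T" "\<forall>y\<in>X - {x}. s y \<noteq> a"
      using a by blast
    then show ?thesis
    proof cases
      case R
      then have "s y = a \<longleftrightarrow> s' y = a" if "y \<in> X" for y using s1[OF that] assms(5,6) by auto
      with R show ?thesis by blast
    next
      case old
      then have "s' y \<in> T'" using s1[of y] assms(5) by blast
      moreover have "\<forall>z\<in>X - {x}. s z = a \<longleftrightarrow> s' z = s' y" using s2[of _ y] old by simp
      ultimately show ?thesis using old by blast
    next
      case new
      have "card (s' ` (X - {x})) \<le> card (X - {x})"
        by (rule card_image_le) (use assms(2) in simp)
      also have "\<dots> < card X"
        using assms(2,3) by (rule card_Diff1_less)
      also have "\<dots> \<le> card T'" by fact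
      finally have "\<not> T' \<subseteq> s' ` (X - {x})"
        using assms(2) by (meson card_mono finite_Diff finite_imageI linorder_not_less)
      then obtain a' where "a' \<in> T'" "a' \<notin> s' ` (X - {x})" by blast
      then show ?thesis using new by blast
    qed
  qed
  then obtain a' where a': "a \<in> R \<and> a' = a \<or> a \<in> T \<and> a' \<in> T'"
    and iff: "\<And>y. y \<in> X \<Longrightarrow> y \<noteq> x \<Longrightarrow> s y = a \<longleftrightarrow> s' y = a'" by blast
  have "agree X R T T' (s(x := a)) (s'(x := a'))"
    unfolding agree_def
  proof (intro conjI ballI)
    fix y assume "y \<in> X"
    then show "(s(x := a)) y \<in> R \<and> (s'(x := a')) y = (s(x := a)) y \<or>
        (s(x := a)) y \<in> T \<and> (s'(x := a')) y \<in> T'"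
      using a' s1[of y] by simp
    fix z assume "z \<in> X"
    then show "(s(x := a)) y = (s(x := a)) z \<longleftrightarrow> (s'(x := a')) y = (s'(x := a')) z"
      using \<open>y \<in> X\<close> iff[of y] iff[of z] s2[of y z] by auto
  qed
  then show ?thesis using a' by blast
qed

text \<open>Induction on the formula: \<open>agree\<close> settles the atoms, and each quantifier is
  one round played from either graph, which is why both twin sets must have at least
  \<open>card X\<close> elements. A single relation \<open>E\<close> describes both graphs, so that
  twins from \<open>T\<close> and \<open>T'\<close> can be compared directly.\<close>

lemma sat_twins_iff:
  assumes vG: "pverts G = R \<union> T" and vH: "pverts H = R \<union> T'"
    and adjG: "\<And>x y. x \<in> R \<union> T \<Longrightarrow> y \<in> R \<union> T \<Longrightarrow> (x, y) \<in> parcs G \<longleftrightarrow> E x y"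
    and adjH: "\<And>x y. x \<in> R \<union> T' \<Longrightarrow> y \<in> R \<union> T' \<Longrightarrow> (x, y) \<in> parcs H \<longleftrightarrow> E x y"
    and twins: "\<And>x y. x \<in> T \<union> T' \<Longrightarrow> y \<in> T \<union> T' \<Longrightarrow> E x y \<longleftrightarrow> x \<noteq> y"
      "\<And>x y r. x \<in> T \<union> T' \<Longrightarrow> y \<in> T \<union> T' \<Longrightarrow> r \<in> R \<Longrightarrow> E x r \<longleftrightarrow> E y r"
      "\<And>x y r. x \<in> T \<union> T' \<Longrightarrow> y \<in> T \<union> T' \<Longrightarrow> r \<in> R \<Longrightarrow> E r x \<longleftrightarrow> E r y"
    and disj: "R \<inter> T = {}" "R \<inter> T' = {}"
    and X: "finite X" "card X \<le> card T" "card X \<le> card T'"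
    and "vars \<phi> \<subseteq> X" and "agree X R T T' s s'"
  shows "sat G s \<phi> \<longleftrightarrow> sat H s' \<phi>"
  using assms(13,14)
proof (induction \<phi> arbitrary: s s')
  case (Eq x y)
  then show ?case unfolding agree_def by simp
next
  case (Adj x y)
  then have "x \<in> X" "y \<in> X" by auto
  with Adj have x: "s x \<in> R \<and> s' x = s x \<or> s x \<in> T \<and> s' x \<in> T'"
    and y: "s y \<in> R \<and> s' y = s y \<or> s y \<in> T \<and> s' y \<in> T'"
    and xy: "s x = s y \<longleftrightarrow> s' x = s' y"
    unfolding agree_def by blast+
  \<comment> \<open>Between two twins adjacency means being distinct, which \<open>agree\<close>
    preserves; against a shared vertex one twin may be exchanged for another.\<close>
  have "E (s x) (s y) \<longleftrightarrow> E (s' x) (s' y)"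
    using x y
  proof (elim disjE conjE)
    assume "s x \<in> T" "s' x \<in> T'" "s y \<in> T" "s' y \<in> T'"
    then show ?thesis using twins(1)[of "s x" "s y"] twins(1)[of "s' x" "s' y"] xy by simp
  qed (use twins(2)[of "s x" "s' x"] twins(3)[of "s y" "s' y"] in simp_all)
  moreover have "(s x, s y) \<in> parcs G \<longleftrightarrow> E (s x) (s y)"
    by (rule adjG) (use x y in auto)
  moreover have "(s' x, s' y) \<in> parcs H \<longleftrightarrow> E (s' x) (s' y)"
    by (rule adjH) (use x y in auto)
  ultimately show ?case by simp
next
  case (Exists x \<phi>)
  then have x: "x \<in> X" and IH: "\<And>t t'. agree X R T T' t t' \<Longrightarrow> sat G t \<phi> \<longleftrightarrow> sat H t' \<phi>"
    by auto
  have "\<exists>a'\<in>R \<union> T'. sat G (s(x := a)) \<phi> = sat H (s'(x := a')) \<phi>" if "a \<in> R \<union> T" for a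
    using agree_extend[OF Exists.prems(2) X(1) x X(3) disj that] IH by blast
  moreover have "\<exists>a\<in>R \<union> T. sat G (s(x := a)) \<phi> = sat H (s'(x := a')) \<phi>" if "a' \<in> R \<union> T'" for a'
    using agree_extend[OF agree_sym[OF Exists.prems(2)] X(1) x X(2) disj(2,1) that]
    by (blast dest: agree_sym IH)
  ultimately show ?case unfolding sat.simps vG vH by blast
next
  case (Forall x \<phi>)
  then have x: "x \<in> X" and IH: "\<And>t t'. agree X R T T' t t' \<Longrightarrow> sat G t \<phi> \<longleftrightarrow> sat H t' \<phi>"
    by auto
  have "\<exists>a'\<in>R \<union> T'. sat G (s(x := a)) \<phi> = sat H (s'(x := a')) \<phi>" if "a \<in> R \<union> T" for a
    using agree_extend[OF Forall.prems(2) X(1) x X(3) disj that] IH by blast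
  moreover have "\<exists>a\<in>R \<union> T. sat G (s(x := a)) \<phi> = sat H (s'(x := a')) \<phi>" if "a' \<in> R \<union> T'" for a'
    using agree_extend[OF agree_sym[OF Forall.prems(2)] X(1) x X(2) disj(2,1) that]
    by (blast dest: agree_sym IH)
  ultimately show ?case unfolding sat.simps vG vH by blast
next
  case (Neg \<phi>)
  then show ?case by simp
next
  case (Conj \<phi> \<psi>)
  then show ?case by simp
next
  case (Disj \<phi> \<psi>)
  then show ?case by simp
qed

subsection \<open>Host graphs\<close>

text \<open>The vertices \<open>0, \<dots>, p\<close> form a path, the next \<open>n\<close> vertices are leaves at \<open>0\<close>, and all
  vertices beyond \<open>p + n\<close> form together with \<open>p\<close> a clique.\<close>

definition host_link :: "nat \<Rightarrow> nat \<Rightarrow> nat \<Rightarrow> nat \<Rightarrow> bool" where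
  "host_link p n x y \<longleftrightarrow>
    y = Suc x \<and> y \<le> p \<or> x = 0 \<and> p < y \<and> y \<le> p + n \<or> (x = p \<or> p + n < x) \<and> p + n < y \<and> x \<noteq> y"

definition host :: "nat \<Rightarrow> nat \<Rightarrow> nat \<Rightarrow> nat pair_pre_digraph" where
  "host p n m = \<lparr> pverts = {..p + n + m},
    parcs = {(x, y). x \<le> p + n + m \<and> y \<le> p + n + m \<and> (host_link p n x y \<or> host_link p n y x)} \<rparr>"

lemma host_simps:
  "pverts (host p n m) = {..p + n + m}"
  "(x, y) \<in> parcs (host p n m) \<longleftrightarrow>
    x \<le> p + n + m \<and> y \<le> p + n + m \<and> (host_link p n x y \<or> host_link p n y x)"
  by (auto simp: host_def)

lemma pair_graph_host: "pair_graph (host p n m)"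
  by (rule pair_graphI) (auto simp: host_simps sym_def irrefl_def host_link_def)

lemma connected_host: "Digraph_Component.connected (with_proj (host p n m))"
proof -
  interpret pair_graph "host p n m" by (rule pair_graph_host)
  have path: "x \<rightarrow>\<^sup>*\<^bsub>with_proj (host p n m)\<^esub> 0" if "x \<le> p" for x
    using that
  proof (induction x)
    case 0
    then show ?case by (simp add: host_simps)
  next
    case (Suc x)
    then have "(Suc x, x) \<in> parcs (host p n m)" by (simp add: host_simps host_link_def)
    with Suc show ?case by (auto intro: adj_reachable_trans)
  qed
  show ?thesis
  proof (rule connectedI_reachable)
    show "0 \<in> pverts (host p n m)" by (simp add: host_simps)
    fix x assume x: "x \<in> pverts (host p n m)"
    consider "x \<le> p" | "p < x" "x \<le> p + n" | "p + n < x" by linarith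
    then show "x \<rightarrow>\<^sup>*\<^bsub>with_proj (host p n m)\<^esub> 0"
    proof cases
      case 2
      then have "(x, 0) \<in> parcs (host p n m)" by (simp add: host_simps host_link_def)
      then show ?thesis by auto
    next
      case 3
      with x have "(x, p) \<in> parcs (host p n m)" by (simp add: host_simps host_link_def)
      then show ?thesis using path[of p] by (auto intro: adj_reachable_trans)
    qed (rule path)
  qed
qed

text \<open>Path and leaves are the shared part, the clique vertices beyond \<open>p + n\<close> the
  twins. Since \<open>host_link\<close> does not depend on the number of twins, it serves as the
  common adjacency.\<close>

lemma host_models_iff:
  assumes "sentence \<phi>" and "card (vars \<phi>) \<le> m" and "card (vars \<phi>) \<le> m'"
  shows "models (host p n m) \<phi> \<longleftrightarrow> models (host p n m') \<phi>"
proof -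
  have "models (host p n m) \<phi> \<longleftrightarrow> sat (host p n m) (\<lambda>_. 0) \<phi>"
    by (rule models_iff_sat[OF assms(1)]) (auto simp: host_simps)
  also have "\<dots> \<longleftrightarrow> sat (host p n m') (\<lambda>_. 0) \<phi>"
  proof (rule sat_twins_iff[where R = "{..p + n}" and T = "{p + n<..p + n + m}"
        and T' = "{p + n<..p + n + m'}" and X = "vars \<phi>"
        and E = "\<lambda>x y. host_link p n x y \<or> host_link p n y x"])
    fix x y r
    assume xy: "x \<in> {p + n<..p + n + m} \<union> {p + n<..p + n + m'}"
      "y \<in> {p + n<..p + n + m} \<union> {p + n<..p + n + m'}"
    then show "host_link p n x y \<or> host_link p n y x \<longleftrightarrow> x \<noteq> y"
      by (auto simp: host_link_def)
    assume "r \<in> {..p + n}"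
    \<comment> \<open>Among the shared vertices \<open>p\<close> alone is adjacent to twins, and it
      is adjacent to all of them.\<close>
    then have *: "host_link p n z r \<or> host_link p n r z \<longleftrightarrow> r = p" if "p + n < z" for z
      using that by (auto simp: host_link_def)
    have "p + n < x" "p + n < y" using xy by auto
    from *[OF this(1)] *[OF this(2)] show "host_link p n x r \<or> host_link p n r x \<longleftrightarrow> host_link p n y r \<or> host_link p n r y"
      "host_link p n r x \<or> host_link p n x r \<longleftrightarrow> host_link p n r y \<or> host_link p n y r"
      by blast+
  qed (use assms finite_vars in \<open>auto simp: host_simps agree_def\<close>)
  also have "\<dots> \<longleftrightarrow> models (host p n m') \<phi>"
    by (rule models_iff_sat[OF assms(1), symmetric]) (auto simp: host_simps)
  finally show ?thesis .
qed

lemma host_contains: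
  assumes "pair_graph F" and "card (pverts F) \<le> m"
  shows "host p n m \<in> graphs_containing F"
proof -
  interpret F: pair_graph F by fact
  have "card (pverts F) \<le> card {p + n<..p + n + m}" using assms(2) by simp
  then obtain f where f: "f ` pverts F \<subseteq> {p + n<..p + n + m}" "inj_on f (pverts F)"
    using card_le_inj[of "pverts F" "{p + n<..p + n + m}"] by auto
  have "(f u, f v) \<in> parcs (host p n m)" if "(u, v) \<in> parcs F" for u v
  proof -
    have "f u \<in> {p + n<..p + n + m}" "f v \<in> {p + n<..p + n + m}" "f u \<noteq> f v"
      using f F.in_arcsD1[OF that] F.in_arcsD2[OF that] F.no_loops'[OF that]
      by (auto dest: inj_onD)
    then show ?thesis by (auto simp: host_simps host_link_def)
  qed
  moreover have "f ` pverts F \<subseteq> pverts (host p n m)" using f(1) by (auto simp: host_simps)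
  ultimately show ?thesis
    unfolding graphs_containing_iff[OF assms(1) pair_graph_host] using f(2) by blast
qed

text \<open>With \<open>card (pverts F)\<close> additional twins the clique alone contains
  \<open>F\<close>, so the sentence holds there. It cannot notice the removal of these twins, hence
  \<open>F\<close> embeds with only \<open>card (vars \<phi>)\<close> of them. The threshold depends
  on \<open>p + n\<close> only, leaving \<open>p\<close> and \<open>n\<close> free to be
  chosen.\<close>

lemma host_embedding:
  assumes "pair_graph F" and "sentence \<phi>" and "defines_asymptotically \<phi> (graphs_containing F)"
  shows "\<exists>N. \<forall>p n. N \<le> p + n \<longrightarrow>
    (\<exists>f. inj_on f (pverts F) \<and> f ` pverts F \<subseteq> {..p + n + card (vars \<phi>)} \<and>
      (\<forall>u v. (u, v) \<in> parcs F \<longrightarrow> host_link p n (f u) (f v) \<or> host_link p n (f v) (f u)))"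
proof -
  let ?k = "card (vars \<phi>)"
  obtain N where N: "\<And>G. pair_graph G \<Longrightarrow> Digraph_Component.connected (with_proj G) \<Longrightarrow>
      N \<le> card (pverts G) \<Longrightarrow> models G \<phi> \<longleftrightarrow> G \<in> graphs_containing F"
    using assms(3) unfolding defines_asymptotically_def by blast
  have "host p n ?k \<in> graphs_containing F" if "N \<le> p + n" for p n
  proof -
    have iff: "models (host p n m) \<phi> \<longleftrightarrow> host p n m \<in> graphs_containing F" for m
      by (rule N[OF pair_graph_host connected_host]) (use that in \<open>simp add: host_simps\<close>)
    have "host p n (?k + card (pverts F)) \<in> graphs_containing F"
      by (rule host_contains[OF assms(1)]) simp
    then show ?thesis
      using iff host_models_iff[OF assms(2), of "?k + card (pverts F)" ?k p n] by simp
  qed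
  then show ?thesis
    unfolding graphs_containing_iff[OF assms(1) pair_graph_host] host_simps by meson
qed

text \<open>The critical vertex is \<open>p\<close>, with \<open>m\<close> clique neighbours and one
  path neighbour. The assumption \<open>m >= 1\<close> covers the inner path vertices, which have
  degree 2.\<close>

lemma host_degree_le:
  assumes "m \<ge> 1"
  shows "card {y. y \<le> p + m \<and> (host_link p 0 x y \<or> host_link p 0 y x)} \<le> m + 1"
    (is "card ?N \<le> _")
proof -
  consider "x < p" | "x = p" | "p < x" by linarith
  then show ?thesis
  proof cases
    case 1
    then have "?N \<subseteq> {x - 1, Suc x}" by (auto simp: host_link_def)
    then have "card ?N \<le> card {x - 1, Suc x}" by (rule card_mono[rotated]) simp
    also have "\<dots> \<le> 2" by (simp add: card_insert_if)
    finally show ?thesis using assms by simp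
  next
    case 2
    then have "?N \<subseteq> insert (p - 1) {p<..p + m}" by (auto simp: host_link_def)
    then have "card ?N \<le> card (insert (p - 1) {p<..p + m})" by (rule card_mono[rotated]) simp
    also have "\<dots> \<le> m + 1" by (simp add: card_insert_if)
    finally show ?thesis .
  next
    case 3
    then have "?N \<subseteq> {p..p + m}" by (auto simp: host_link_def)
    then have "card ?N \<le> card {p..p + m}" by (rule card_mono[rotated]) simp
    then show ?thesis by simp
  qed
qed

text \<open>Take as host a clique with a long path attached: its maximum degree is one more than the
  number of twins.\<close>

lemma out_degree_le_card_vars:
  assumes "pair_graph F" and "sentence \<phi>" and "defines_asymptotically \<phi> (graphs_containing F)"
  shows "out_degree (with_proj F) u \<le> card (vars \<phi>) + 1"
proof -
  interpret F: pair_graph F by fact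
  let ?k = "card (vars \<phi>)"
  obtain N f where f: "inj_on f (pverts F)" "f ` pverts F \<subseteq> {..N + 0 + ?k}"
    "\<And>u v. (u, v) \<in> parcs F \<Longrightarrow> host_link N 0 (f u) (f v) \<or> host_link N 0 (f v) (f u)"
    using host_embedding[OF assms] by (metis add.right_neutral order_refl)
  have sub: "{v. (u, v) \<in> parcs F} \<subseteq> pverts F" by (auto dest: F.in_arcsD2)
  have "card {v. (u, v) \<in> parcs F} = card (f ` {v. (u, v) \<in> parcs F})"
    by (rule card_image[symmetric]) (rule inj_on_subset[OF f(1) sub])
  also have "\<dots> \<le> card {y. y \<le> N + ?k \<and> (host_link N 0 (f u) y \<or> host_link N 0 y (f u))}"
    by (rule card_mono) (use f(2,3) F.in_arcsD2 in \<open>auto simp: image_subset_iff\<close>)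
  also have "\<dots> \<le> ?k + 1"
    by (rule host_degree_le) (use finite_vars vars_nonempty in \<open>simp add: Suc_le_eq card_gt_0_iff\<close>)
  finally show ?thesis by (simp add: out_degree_pair)
qed

subsection \<open>Pendant sparklers\<close>

lemma sparkler_simps:
  "pverts (sparkler q p) = {Center} \<union> Leaf ` {1..q - 1} \<union> Path ` {1..p}"
  "(Center, Center) \<notin> parcs (sparkler q p)"
  "(Leaf i, Leaf j) \<notin> parcs (sparkler q p)"
  "(Leaf i, Path j) \<notin> parcs (sparkler q p)"
  "(Path i, Leaf j) \<notin> parcs (sparkler q p)"
  "(Center, Leaf i) \<in> parcs (sparkler q p) \<longleftrightarrow> i \<in> {1..q - 1}"
  "(Leaf i, Center) \<in> parcs (sparkler q p) \<longleftrightarrow> i \<in> {1..q - 1}"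
  "(Center, Path i) \<in> parcs (sparkler q p) \<longleftrightarrow> i = 1 \<and> i \<le> p"
  "(Path i, Center) \<in> parcs (sparkler q p) \<longleftrightarrow> i = 1 \<and> i \<le> p"
  "(Path i, Path j) \<in> parcs (sparkler q p) \<longleftrightarrow>
    1 \<le> i \<and> j = i + 1 \<and> j \<le> p \<or> 1 \<le> j \<and> i = j + 1 \<and> i \<le> p"
  by (auto simp: sparkler_def Let_def)

lemma parcs_sparkler_subset: "parcs (sparkler q p) \<subseteq> pverts (sparkler q p) \<times> pverts (sparkler q p)"
  by (auto simp: sparkler_def Let_def image_iff)

text \<open>The point is finiteness of the set under \<open>Max\<close>: the \<open>p\<close> path
  vertices of a pendant sparkler are distinct vertices of \<open>F\<close>.\<close>

lemma sp_ge:
  assumes "pair_graph F" and "pendant_sparkler F v S q p"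
  shows "p \<le> sp F"
proof -
  interpret F: pair_graph F by fact
  have "p' \<le> card (pverts F)" if ps: "pendant_sparkler F v' S' q' p'" for v' S' q' p'
  proof -
    from ps obtain C hom where v': "v' \<in> pverts F"
      and C: "C \<in> pre_digraph.sccs_verts (pre_digraph.del_vert (with_proj F) v')"
      and S': "S' = with_proj F \<restriction> insert v' C"
      and hom: "app_iso hom S' = with_proj (sparkler q' p')"
      unfolding pendant_sparkler_def branches_def by blast
    have "C \<subseteq> verts (pre_digraph.del_vert (with_proj F) v')"
      by (rule wf_digraph.sccs_verts_subsets[OF F.wf_digraph_del_vert C])
    with v' S' have "verts S' \<subseteq> pverts F" by (auto simp: pre_digraph.verts_del_vert)
    have "pverts (sparkler q' p') = iso_verts hom ` verts S'"
      using arg_cong[OF hom, of verts] by simp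
    then have "Path ` {1..p'} \<subseteq> iso_verts hom ` pverts F"
      using \<open>verts S' \<subseteq> pverts F\<close> by (auto simp: sparkler_simps)
    then have "card (Path ` {1..p'}) \<le> card (pverts F)"
      by (rule surj_card_le[OF F.pair_finite_verts])
    then show ?thesis by (simp add: card_image inj_on_def)
  qed
  then have "{p. \<exists>v S q. pendant_sparkler F v S q p} \<subseteq> {..card (pverts F)}"
    by blast
  then have "finite {p. \<exists>v S q. pendant_sparkler F v S q p}"
    using finite_subset by blast
  then show ?thesis unfolding sp_def by (rule Max_ge) (use assms(2) in blast)
qed

text \<open>A concrete embedding is most easily given from the model \<open>H\<close> into
  \<open>F\<close>, whereas \<open>pendant_sparkler\<close> asks for an isomorphism from the branch
  onto the model. Inverting \<open>g\<close> bridges the two.\<close>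

lemma induced_iso:
  assumes "pair_graph F" and "D \<subseteq> pverts F"
    and g: "bij_betw g (pverts H) D" and H: "parcs H \<subseteq> pverts H \<times> pverts H"
    and arcs: "\<And>a b. a \<in> pverts H \<Longrightarrow> b \<in> pverts H \<Longrightarrow> (g a, g b) \<in> parcs F \<longleftrightarrow> (a, b) \<in> parcs H"
  shows "\<exists>hom. pre_digraph.digraph_isomorphism (with_proj F \<restriction> D) hom \<and>
    app_iso hom (with_proj F \<restriction> D) = with_proj H \<and> (\<forall>a\<in>pverts H. iso_verts hom (g a) = a)"
proof -
  interpret F: pair_graph F by fact
  define h where "h = the_inv_into (pverts H) g"
  have hg: "h (g a) = a" if "a \<in> pverts H" for a
    using g that by (simp add: h_def bij_betw_def the_inv_into_f_f)
  have D: "D = g ` pverts H" using g by (simp add: bij_betw_def)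
  have h: "bij_betw h D (pverts H)"
    unfolding h_def by (rule bij_betw_the_inv_into[OF g])
  define hom where "hom = \<lparr> iso_verts = h, iso_arcs = map_prod h h,
      iso_head = snd, iso_tail = fst \<rparr>"
  let ?A = "{e \<in> parcs F. fst e \<in> D \<and> snd e \<in> D}"
  have A: "?A = map_prod g g ` parcs H"
  proof
    show "?A \<subseteq> map_prod g g ` parcs H"
      using arcs by (auto simp: D)
    show "map_prod g g ` parcs H \<subseteq> ?A"
      using arcs H by (auto simp: D)
  qed
  have "map_prod h h ` ?A = (\<lambda>e. e) ` parcs H"
    unfolding A image_image
  proof (rule image_cong)
    fix e assume "e \<in> parcs H"
    then show "map_prod h h (map_prod g g e) = e"
      using H hg by (cases e) auto
  qed simp
  then have "app_iso hom (with_proj F \<restriction> D) = with_proj H"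
    using h by (simp add: app_iso_def with_proj_def induce_subgraph_def hom_def bij_betw_def)
  moreover have "inj_on (map_prod h h) ?A"
    using h by (intro inj_on_subset[OF map_prod_inj_on[of h D h D]]) (auto simp: bij_betw_def)
  then have "pre_digraph.digraph_isomorphism (with_proj F \<restriction> D) hom"
    unfolding pre_digraph.digraph_isomorphism_def
    using h F.wellformed_induce_subgraph[of D] by (auto simp: hom_def bij_betw_def)
  ultimately show ?thesis using hg by (intro exI[of _ hom]) (auto simp: hom_def)
qed

text \<open>The star with centre \<open>w 0\<close> and leaves \<open>L\<close>, together with the path \<open>w 0, \<dots>, w t\<close>, is a sparkler
  with tail end \<open>w t\<close>, and only the tail end may have neighbours outside.\<close>

definition sparkler_at :: "'a pair_pre_digraph \<Rightarrow> 'a set \<Rightarrow> (nat \<Rightarrow> 'a) \<Rightarrow> nat \<Rightarrow> bool" where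
  "sparkler_at F L w t \<longleftrightarrow> 1 \<le> t \<and> inj_on w {..t} \<and> w ` {..t} \<inter> L = {} \<and>
    w ` {..t} \<subseteq> pverts F \<and> L \<subseteq> pverts F \<and>
    (\<forall>x\<in>L. \<forall>u. (x, u) \<in> parcs F \<longleftrightarrow> u = w 0) \<and>
    (\<forall>u. (w 0, u) \<in> parcs F \<longleftrightarrow> u \<in> L \<or> u = w 1) \<and>
    (\<forall>i u. 0 < i \<and> i < t \<longrightarrow> ((w i, u) \<in> parcs F \<longleftrightarrow> u = w (i - 1) \<or> u = w (i + 1))) \<and>
    (w t, w (t - 1)) \<in> parcs F"

context
  fixes F :: "'a pair_pre_digraph" and L w t
  assumes F: "pair_graph F" and at: "sparkler_at F L w t"
begin

interpretation F: pair_graph F by (rule F)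

private lemma
  shows t_pos: "1 \<le> t" and inj_w: "inj_on w {..t}" and w_notin_L: "\<And>i. i \<le> t \<Longrightarrow> w i \<notin> L"
    and w_verts: "\<And>i. i \<le> t \<Longrightarrow> w i \<in> pverts F" and L_verts: "L \<subseteq> pverts F"
    and L_adj: "\<And>x u. x \<in> L \<Longrightarrow> (x, u) \<in> parcs F \<longleftrightarrow> u = w 0"
    and center_adj: "\<And>u. (w 0, u) \<in> parcs F \<longleftrightarrow> u \<in> L \<or> u = w 1"
    and path_adj: "\<And>i u. 0 < i \<Longrightarrow> i < t \<Longrightarrow> (w i, u) \<in> parcs F \<longleftrightarrow> u = w (i - 1) \<or> u = w (i + 1)"
    and end_adj: "(w t, w (t - 1)) \<in> parcs F"
  using at unfolding sparkler_at_def by (simp_all add: disjoint_iff image_subset_iff)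

private lemma w_eq_iff: "i \<le> t \<Longrightarrow> j \<le> t \<Longrightarrow> w i = w j \<longleftrightarrow> i = j"
  using inj_w by (auto dest: inj_onD)

private lemma arcs_sym_iff: "(u, v) \<in> parcs F \<longleftrightarrow> (v, u) \<in> parcs F"
  by (auto intro: F.arcs_symmetric)

private lemma w_w_adj:
  assumes "i \<le> t" and "j \<le> t"
  shows "(w i, w j) \<in> parcs F \<longleftrightarrow> j = Suc i \<or> i = Suc j"
proof -
  \<comment> \<open>The smaller index is never \<open>t\<close>, so the full neighbourhood of
    \<open>w i\<close> is known; the other order follows by symmetry of the arcs.\<close>
  have less: "(w i, w j) \<in> parcs F \<longleftrightarrow> j = Suc i" if "i < j" "j \<le> t" for i j
  proof (cases i)
    case 0
    then show ?thesis using that center_adj[of "w j"] w_notin_L[of j] w_eq_iff[of j 1] t_pos by simp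
  next
    case (Suc i')
    then show ?thesis
      using that path_adj[of i "w j"] w_eq_iff[of j i'] w_eq_iff[of j "Suc i"] by auto
  qed
  consider "i < j" | "i = j" | "j < i" by linarith
  then show ?thesis
  proof cases
    case 1 then show ?thesis using less[of i j] assms by simp
  next
    case 2 then show ?thesis using F.no_loops'[of "w i" "w i"] by auto
  next
    case 3 then show ?thesis using less[of j i] assms arcs_sym_iff[of "w i"] by auto
  qed
qed

private lemma L_w_adj: "x \<in> L \<Longrightarrow> i \<le> t \<Longrightarrow> (x, w i) \<in> parcs F \<longleftrightarrow> i = 0"
  using L_adj[of x "w i"] w_eq_iff[of i 0] by simp

text \<open>Every vertex of the set reaches \<open>w 0\<close> without using \<open>w t\<close>. No
  arc leaves the set after the removal of \<open>w t\<close>, because only the tail end may have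
  neighbours outside the sparkler.\<close>

private lemma component: "L \<union> w ` {..<t} \<in> pre_digraph.sccs_verts (pre_digraph.del_vert (with_proj F) (w t))"
proof -
  let ?D = "pre_digraph.del_vert (with_proj F) (w t)"
  interpret D: wf_digraph ?D by (rule F.wf_digraph_del_vert)
  have ends: "(u, v) \<in> arcs_ends ?D \<longleftrightarrow> (u, v) \<in> parcs F \<and> u \<noteq> w t \<and> v \<noteq> w t" for u v
    by (auto simp: arcs_ends_conv pre_digraph.del_vert_simps image_iff)
  have sym: "symmetric ?D"
    by (auto simp: symmetric_def sym_def ends intro: F.arcs_symmetric)
  have w: "w i \<rightarrow>\<^sup>*\<^bsub>?D\<^esub> w 0" if "i < t" for i
    using that
  proof (induction i)
    case 0
    then show ?case using w_verts[of 0] w_eq_iff[of 0 t] by (auto simp: pre_digraph.verts_del_vert)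
  next
    case (Suc i)
    then have "(w (Suc i), w i) \<in> arcs_ends ?D"
      using w_w_adj[of "Suc i" i] w_eq_iff[of _ t] by (auto simp: ends)
    then show ?case using Suc D.adj_reachable_trans by auto
  qed
  have L: "x \<rightarrow>\<^sup>*\<^bsub>?D\<^esub> w 0" if "x \<in> L" for x
  proof -
    have "(x, w 0) \<in> arcs_ends ?D"
      using that L_adj[of x "w 0"] w_eq_iff[of 0 t] t_pos w_notin_L[of t] by (auto simp: ends)
    then show ?thesis by (rule D.reachable_adjI)
  qed
  have reach: "u \<rightarrow>\<^sup>*\<^bsub>?D\<^esub> w 0" if "u \<in> L \<union> w ` {..<t}" for u
    using that w L by auto
  have closed: "v \<in> L \<union> w ` {..<t}" if "u \<rightarrow>\<^sup>*\<^bsub>?D\<^esub> v" "u \<in> L \<union> w ` {..<t}" for u v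
    using that
  proof (induction rule: D.reachable_induct)
    case (step x y)
    then have xy: "(x, y) \<in> parcs F" "y \<noteq> w t" and "x \<in> L \<union> w ` {..<t}" by (auto simp: ends)
    then consider "x \<in> L" | "x = w 0" | i where "x = w i" "0 < i" "i < t"
      by (auto simp: image_iff)
    then show ?case
    proof cases
      case 1
      then show ?thesis using xy L_adj t_pos by auto
    next
      case 2
      then have "y \<in> L \<or> y = w 1" using xy center_adj by simp
      then show ?thesis using xy(2) t_pos by (cases "t = 1") auto
    next
      case 3
      then have "y = w (i - 1) \<or> y = w (i + 1)" using xy path_adj by simp
      moreover have "i + 1 < t" if "y = w (i + 1)" using that 3 xy(2) by (cases "i + 1 = t") auto
      ultimately show ?thesis using 3 by auto
    qed
  qed
  show ?thesis
    unfolding D.in_sccs_verts_conv_reachable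
  proof (intro conjI ballI allI impI)
    show "L \<union> w ` {..<t} \<noteq> {}" using t_pos by (auto simp: lessThan_empty_iff)
    fix u assume u: "u \<in> L \<union> w ` {..<t}"
    show "u \<rightarrow>\<^sup>*\<^bsub>?D\<^esub> v" if "v \<in> L \<union> w ` {..<t}" for v
      using D.reachable_trans[OF reach[OF u] symmetric_reachable[OF sym reach[OF that]]] .
    show "\<not> u \<rightarrow>\<^sup>*\<^bsub>?D\<^esub> v \<or> \<not> v \<rightarrow>\<^sup>*\<^bsub>?D\<^esub> u" if "v \<notin> L \<union> w ` {..<t}" for v
      using closed[of u v] u that by blast
  qed
qed

text \<open>The parameter \<open>q\<close> is \<open>card L + 1\<close>, as the star of a sparkler
  has \<open>q - 1\<close> leaves besides the path; two leaves thus give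
  \<open>q >= 3\<close>.\<close>

lemma pendant_sparkler_of_sparkler_at:
  assumes "2 \<le> card L" and deg: "3 \<le> out_degree (with_proj F) (w t) \<or> out_degree (with_proj F) (w t) = 1"
  shows "pendant_sparkler F (w t) (with_proj F \<restriction> insert (w t) (L \<union> w ` {..<t})) (card L + 1) t"
proof -
  have "finite L" using L_verts F.pair_finite_verts by (rule finite_subset)
  then obtain e where e: "bij_betw e {1..card L} L"
    using ex_bij_betw_nat_finite_1 by blast
  then have eL: "\<And>i. i \<in> {1..card L} \<Longrightarrow> e i \<in> L" and inj_e: "inj_on e {1..card L}"
    by (auto simp: bij_betw_def)
  define g where "g = (\<lambda>a. case a of Center \<Rightarrow> w 0 | Leaf i \<Rightarrow> e i | Path i \<Rightarrow> w i)"
  let ?S = "sparkler (card L + 1) t"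
  let ?V = "insert (w t) (L \<union> w ` {..<t})"
  have V: "?V = L \<union> w ` {..t}" by (auto simp: lessThan_Suc_atMost[symmetric] lessThan_Suc)
  have e_eq: "e i = e j \<longleftrightarrow> i = j" if "1 \<le> i" "i \<le> card L" "1 \<le> j" "j \<le> card L" for i j
    using inj_e that by (auto dest: inj_onD)
  have e_neq: "e i \<noteq> w j" "w j \<noteq> e i" if "1 \<le> i" "i \<le> card L" "j \<le> t" for i j
    using eL[of i] w_notin_L[of j] that by auto
  have e_w: "(e i, w j) \<in> parcs F \<longleftrightarrow> j = 0" "(w j, e i) \<in> parcs F \<longleftrightarrow> j = 0"
    if "1 \<le> i" "i \<le> card L" "j \<le> t" for i j
    using L_w_adj[of "e i" j] eL[of i] that arcs_sym_iff[of "w j"] by auto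
  have e_e: "(e i, e j) \<notin> parcs F" if "1 \<le> i" "i \<le> card L" "1 \<le> j" "j \<le> card L" for i j
    using L_adj[of "e i" "e j"] eL[of i] e_neq[of j 0] that by auto
  have verts_cases: "a = Center \<or> (\<exists>i. a = Leaf i \<and> 1 \<le> i \<and> i \<le> card L) \<or>
      (\<exists>i. a = Path i \<and> 1 \<le> i \<and> i \<le> t)" if "a \<in> pverts ?S" for a
    using that by (auto simp: sparkler_simps)
  have "inj_on g (pverts ?S)"
  proof (rule inj_onI)
    fix a b assume "a \<in> pverts ?S" "b \<in> pverts ?S" "g a = g b"
    with verts_cases[of a] verts_cases[of b] show "a = b"
      by (auto simp: g_def e_eq e_neq w_eq_iff)
  qed
  moreover have "g ` pverts ?S = ?V"
  proof -
    have "g ` pverts ?S = {w 0} \<union> e ` {1..card L} \<union> w ` {1..t}"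
      by (simp add: sparkler_simps g_def image_Un image_image)
    also have "\<dots> = L \<union> w ` insert 0 {1..t}" using e by (auto simp: bij_betw_def)
    also have "insert 0 {1..t} = {..t}" by auto
    finally show ?thesis using V by simp
  qed
  ultimately have g: "bij_betw g (pverts ?S) ?V" by (simp add: bij_betw_def)
  have "(g a, g b) \<in> parcs F \<longleftrightarrow> (a, b) \<in> parcs ?S" if "a \<in> pverts ?S" "b \<in> pverts ?S" for a b
    using verts_cases[OF that(1)] verts_cases[OF that(2)]
    by (auto simp: g_def sparkler_simps e_w e_e w_w_adj)
  then obtain hom where "pre_digraph.digraph_isomorphism (with_proj F \<restriction> ?V) hom"
    "app_iso hom (with_proj F \<restriction> ?V) = with_proj ?S" "\<forall>a\<in>pverts ?S. iso_verts hom (g a) = a"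
    using induced_iso[OF F _ g parcs_sparkler_subset] L_verts w_verts unfolding V by blast
  moreover have "Path t \<in> pverts ?S" "g (Path t) = w t" using t_pos by (auto simp: sparkler_simps g_def)
  moreover have "tail_end t = Path t" using t_pos by (simp add: tail_end_def)
  ultimately show ?thesis
    unfolding pendant_sparkler_def branches_def
    using assms component w_verts[of t] by fastforce
qed

text \<open>The second neighbour of \<open>w t\<close> is new: leaves see only \<open>w 0\<close>,
  and \<open>w (t - 1)\<close> is the only earlier path vertex adjacent to \<open>w t\<close>. It
  can therefore serve as the next tail end.\<close>

lemma sparkler_at_extend:
  assumes "out_degree (with_proj F) (w t) = 2"
  shows "\<exists>w'. sparkler_at F L w' (Suc t)"
proof -
  have "card {u. (w t, u) \<in> parcs F} = 2" using assms by (simp add: out_degree_pair)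
  then obtain x y where xy: "{u. (w t, u) \<in> parcs F} = {x, y}" "x \<noteq> y"
    by (auto simp: card_2_iff)
  moreover have "w (t - 1) \<in> {u. (w t, u) \<in> parcs F}" using end_adj by simp
  ultimately obtain u where u: "u \<noteq> w (t - 1)" "{u. (w t, u) \<in> parcs F} = {w (t - 1), u}"
    by (metis insert_commute insertE singletonD)
  have adj: "(w t, v) \<in> parcs F \<longleftrightarrow> v = w (t - 1) \<or> v = u" for v
    using u(2) by blast
  have "u \<notin> L"
    using adj[of u] L_w_adj[of u t] arcs_sym_iff[of u "w t"] t_pos by auto
  moreover have u_neq: "u \<noteq> w i" if "i \<le> t" for i
    using adj[of u] w_w_adj[of t i] that u(1) by auto
  moreover have "u \<in> pverts F" using adj[of u] F.in_arcsD2 by blast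
  moreover have "inj_on (w(Suc t := u)) {..Suc t}"
    using inj_w u_neq by (auto simp: atMost_Suc inj_on_def)
  moreover have "(w i, v) \<in> parcs F \<longleftrightarrow> v = w (i - 1) \<or> v = (w(Suc t := u)) (i + 1)"
    if "0 < i" "i < Suc t" for i v
    using path_adj[of i v] adj[of v] that by (cases "i = t") auto
  moreover have "(u, w t) \<in> parcs F" using adj[of u] arcs_sym_iff[of u] by simp
  ultimately have "sparkler_at F L (w(Suc t := u)) (Suc t)"
    unfolding sparkler_at_def
    by (intro conjI ballI allI impI)
      (use t_pos w_notin_L w_verts L_verts L_adj center_adj in \<open>auto simp: atMost_Suc\<close>)
  then show ?thesis by blast
qed

end

text \<open>Keep \<open>L\<close> and take the longest possible tail, whose length is bounded by the
  number of vertices. Its end does not have degree 2, since the tail could be extended, nor degree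
  0, since it has a predecessor; so the sparkler is pendant.\<close>

lemma sparkler_at_le_sp:
  assumes F: "pair_graph F" and "sparkler_at F L w t" and "2 \<le> card L"
  shows "t \<le> sp F"
proof -
  interpret F: pair_graph F by fact
  let ?P = "\<lambda>t. \<exists>w. sparkler_at F L w t"
  have bound: "t' \<le> card (pverts F)" if "?P t'" for t'
  proof -
    from that obtain w' where "inj_on w' {..t'}" "w' ` {..t'} \<subseteq> pverts F"
      unfolding sparkler_at_def by blast
    then have "card {..t'} \<le> card (pverts F)"
      by (rule card_inj_on_le) (rule F.pair_finite_verts)
    then show ?thesis by simp
  qed
  define m where "m = (GREATEST t. ?P t)"
  have "?P m" unfolding m_def
    using assms(2) bound by (intro GreatestI_nat[where P = ?P]) blast+
  then obtain w' where w': "sparkler_at F L w' m" by blast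
  have "t \<le> m" unfolding m_def
    using assms(2) bound by (intro Greatest_le_nat[where P = ?P]) blast+
  have "\<not> ?P (Suc m)"
    using bound Greatest_le_nat[where P = ?P and k = "Suc m" and b = "card (pverts F)"]
    unfolding m_def[symmetric] by auto
  then have "out_degree (with_proj F) (w' m) \<noteq> 2"
    using sparkler_at_extend[OF F w'] by blast
  moreover have "out_degree (with_proj F) (w' m) \<noteq> 0"
  proof -
    have "(w' m, w' (m - 1)) \<in> parcs F" using w' unfolding sparkler_at_def by blast
    then have "(w' m, w' (m - 1)) \<in> out_arcs (with_proj F) (w' m)" by simp
    then show ?thesis
      using F.finite_out_arcs[of "w' m"] unfolding out_degree_def by (metis card_0_eq empty_iff)
  qed
  ultimately have "3 \<le> out_degree (with_proj F) (w' m) \<or> out_degree (with_proj F) (w' m) = 1"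
    by linarith
  from pendant_sparkler_of_sparkler_at[OF F w' assms(3) this] have "m \<le> sp F"
    by (rule sp_ge[OF F])
  with \<open>t \<le> m\<close> show ?thesis by simp
qed

section \<open>Sparklers in embedded copies of \<open>F\<close>, and the final count\<close>

text \<open>\<open>L\<close> consists of the vertices placed on host leaves and \<open>w\<close> is
  the host path pulled back along \<open>f\<close>. Inside the path the host has no further edges,
  so connectedness of \<open>F\<close> determines all adjacencies except those at the tail
  end.\<close>

lemma sparkler_at_of_host_embedding:
  assumes F: "pair_graph F" and conn: "Digraph_Component.connected (with_proj F)" and p: "1 \<le> p"
    and inj: "inj_on f (pverts F)" and ran: "f ` pverts F \<subseteq> {..p + n + m}"
    and arcs: "\<And>u v. (u, v) \<in> parcs F \<Longrightarrow> host_link p n (f u) (f v) \<or> host_link p n (f v) (f u)"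
    and large: "m + p + 3 \<le> card (pverts F)"
    and degree: "\<And>u. out_degree (with_proj F) u < card (pverts F) - p"
  shows "\<exists>L w. 2 \<le> card L \<and> sparkler_at F L w p"
proof -
  interpret F: pair_graph F by fact
  define L where "L = {u \<in> pverts F. p < f u \<and> f u \<le> p + n}"
  have "finite L" by (simp add: L_def)
  have "f ` (pverts F - L) \<subseteq> {..p} \<union> {p + n<..p + n + m}"
    using ran by (auto simp: L_def)
  then have "card (pverts F - L) \<le> card ({..p} \<union> {p + n<..p + n + m})"
    using inj by (intro card_inj_on_le[of f]) (auto intro: inj_on_subset)
  also have "\<dots> = p + 1 + m" by (subst card_Un_disjoint) auto
  \<comment> \<open>The host offers \<open>p + 1\<close> path vertices and \<open>m\<close> clique
    vertices; \<open>large\<close> leaves a surplus of two, which must lie on leaves.\<close>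
  finally have card_L: "2 \<le> card L"
    using large card_Diff_subset[OF \<open>finite L\<close>, of "pverts F"] by (auto simp: L_def)
  then obtain x0 where x0: "x0 \<in> L" by fastforce
  then have x0_verts: "x0 \<in> pverts F" by (simp add: L_def)

  have L_arc: "f u = 0" if "x \<in> L" "(x, u) \<in> parcs F" for x u
    using arcs[OF that(2)] that(1) by (auto simp: L_def host_link_def)
  have L_neighbour: "\<exists>u. (x, u) \<in> parcs F \<and> f u = 0" if "x \<in> L" for x
  proof -
    \<comment> \<open>The second leaf serves as a vertex other than \<open>x\<close>, so
      connectedness gives \<open>x\<close> a neighbour, necessarily placed at 0.\<close>
    have "\<not> L \<subseteq> {x}"
      using card_L card_mono[of "{x}" L] by auto
    then obtain y where "y \<in> L" "y \<notin> {x}" by blast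
    then have "\<exists>u. (x, u) \<in> parcs F"
      using F.connected_crossing_arc[OF conn, of x "{x}" y] \<open>x \<in> L\<close> by (auto simp: L_def)
    then show ?thesis using L_arc[OF that] by auto
  qed
  obtain c where c: "(x0, c) \<in> parcs F" "f c = 0" using L_neighbour[OF x0] by blast
  have c_verts: "c \<in> pverts F" using c(1) by (rule F.in_arcsD2)
  have c_unique: "u = c" if "u \<in> pverts F" "f u = 0" for u
    using inj_onD[OF inj, of u c] that c(2) c_verts by simp
  have L_adj: "(x, u) \<in> parcs F \<longleftrightarrow> u = c" if "x \<in> L" for x u
    using L_neighbour[OF that] L_arc[OF that, of u] c_unique F.in_arcsD2 by metis

  \<comment> \<open>Removing \<open>p\<close> separates the leaves from the clique. A copy avoiding
    \<open>p\<close> thus lies on the leaves and the \<open>p\<close> vertices before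
    \<open>p\<close>, so at least \<open>card (pverts F) - p\<close> of its vertices are leaves
    adjacent to \<open>c\<close>, against \<open>degree\<close>.\<close>
  have "p \<in> f ` pverts F"
  proof (rule ccontr)
    assume no_p: "p \<notin> f ` pverts F"
    have low: "f u < p \<or> u \<in> L" if u: "u \<in> pverts F" for u
    proof (rule ccontr)
      let ?A = "{v \<in> pverts F. f v < p} \<union> L"
      assume "\<not> (f u < p \<or> u \<in> L)"
      then have "u \<notin> ?A" by blast
      then obtain a b where ab: "(a, b) \<in> parcs F" "a \<in> ?A" "b \<notin> ?A"
        using F.connected_crossing_arc[OF conn _ x0_verts u] x0 by blast
      have "b \<in> pverts F" using ab(1) by (rule F.in_arcsD2)
      then have "f b \<noteq> p" using no_p by auto
      with ab arcs[OF ab(1)] \<open>b \<in> pverts F\<close> p show False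
        by (auto simp: L_def host_link_def)
    qed
    have "card (pverts F - L) \<le> card {..<p}"
      using inj low by (intro card_inj_on_le[of f]) (auto intro: inj_on_subset)
    then have "card (pverts F) - p \<le> card L"
      using card_Diff_subset[OF \<open>finite L\<close>, of "pverts F"] by (auto simp: L_def)
    also have "card L \<le> card {u. (c, u) \<in> parcs F}"
    proof (rule card_mono)
      show "finite {u. (c, u) \<in> parcs F}"
        by (rule finite_subset[OF _ F.pair_finite_verts]) (auto dest: F.in_arcsD2)
      show "L \<subseteq> {u. (c, u) \<in> parcs F}" using L_adj F.arcs_symmetric by blast
    qed
    finally show False using degree[of c] by (simp add: out_degree_pair)
  qed
  then obtain z where z: "z \<in> pverts F" "f z = p" by blast

  text \<open>The only edge of the host leaving the leaves and the first \<open>i\<close> path vertices is the next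
    path edge, so a connected subgraph reaching the end of the path uses it.\<close>
  have step: "\<exists>a b. (a, b) \<in> parcs F \<and> f a = i \<and> f b = Suc i" if "i < p" for i
  proof -
    let ?A = "{v \<in> pverts F. f v \<le> i} \<union> L"
    have "z \<notin> ?A" using z that by (auto simp: L_def)
    then obtain a b where ab: "(a, b) \<in> parcs F" "a \<in> ?A" "b \<notin> ?A"
      using F.connected_crossing_arc[OF conn _ x0_verts z(1)] x0 by blast
    have "b \<in> pverts F" using ab(1) by (rule F.in_arcsD2)
    with ab arcs[OF ab(1)] that have "f a = i \<and> f b = Suc i"
      by (auto simp: L_def host_link_def)
    with ab show ?thesis by blast
  qed
  \<comment> \<open>Each position \<open>i < p\<close> has a preimage by \<open>step\<close>, and
    \<open>p\<close> has the preimage \<open>z\<close>.\<close>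
  define w where "w = the_inv_into (pverts F) f"
  have w_f: "w (f u) = u" if "u \<in> pverts F" for u
    unfolding w_def by (rule the_inv_into_f_f[OF inj that])
  have "\<exists>u\<in>pverts F. f u = i" if "i \<le> p" for i
  proof (cases "i = p")
    case True
    then show ?thesis using z by blast
  next
    case False
    then show ?thesis using step[of i] that F.in_arcsD1 by force
  qed
  then have w: "w i \<in> pverts F" "f (w i) = i" if "i \<le> p" for i
    using that w_f by metis+
  have w_step: "(w i, w (Suc i)) \<in> parcs F" if i: "i < p" for i
  proof -
    obtain a b where ab: "(a, b) \<in> parcs F" "f a = i" "f b = Suc i" using step[OF i] by blast
    then show ?thesis using w_f[of a] w_f[of b] F.in_arcsD1 F.in_arcsD2 by auto
  qed
  have w0: "w 0 = c" using c_unique[OF w(1) w(2)] by simp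
  \<comment> \<open>As \<open>p >= 1\<close>, the host vertex 0 is adjacent only to 1 and the
    leaves, and \<open>F\<close> contains all these edges at the vertices it uses.\<close>
  have center: "(w 0, u) \<in> parcs F \<longleftrightarrow> u \<in> L \<or> u = w 1" for u
  proof
    assume a: "(w 0, u) \<in> parcs F"
    then have "u \<in> pverts F" by (rule F.in_arcsD2)
    moreover have "f u = 1 \<or> p < f u \<and> f u \<le> p + n"
      using arcs[OF a] p w(2)[of 0] by (auto simp: host_link_def)
    ultimately show "u \<in> L \<or> u = w 1" using w_f[of u] by (auto simp: L_def)
  next
    assume "u \<in> L \<or> u = w 1"
    then show "(w 0, u) \<in> parcs F"
      using L_adj[of u c] F.arcs_symmetric[of u c] w_step[of 0] p w0 by auto
  qed
  have path: "(w i, u) \<in> parcs F \<longleftrightarrow> u = w (i - 1) \<or> u = w (i + 1)" if "0 < i" "i < p" for i u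
  proof
    assume a: "(w i, u) \<in> parcs F"
    then have "u \<in> pverts F" by (rule F.in_arcsD2)
    moreover have "f u = i - 1 \<or> f u = i + 1"
      using arcs[OF a] that w(2)[of i] by (auto simp: host_link_def)
    ultimately show "u = w (i - 1) \<or> u = w (i + 1)" using w_f[of u] by auto
  next
    assume "u = w (i - 1) \<or> u = w (i + 1)"
    then show "(w i, u) \<in> parcs F"
      using w_step[of i] w_step[of "i - 1"] F.arcs_symmetric[of "w (i - 1)" "w i"] that by auto
  qed
  have "inj_on w {..p}" by (rule inj_on_inverseI[of _ f]) (use w in auto)
  moreover have "w ` {..p} \<inter> L = {}" using w by (fastforce simp: L_def)
  moreover have "w ` {..p} \<subseteq> pverts F" "L \<subseteq> pverts F" using w by (auto simp: L_def)
  moreover have "(w p, w (p - 1)) \<in> parcs F"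
    using w_step[of "p - 1"] p F.arcs_symmetric[of "w (p - 1)" "w p"] by simp
  ultimately have "sparkler_at F L w p"
    unfolding sparkler_at_def using p L_adj center path w0 by blast
  with card_L show ?thesis by blast
qed

lemma card_vars_ge:
  assumes F: "pair_graph F" and conn: "Digraph_Component.connected (with_proj F)"
    and \<phi>: "sentence \<phi>" "defines_asymptotically \<phi> (graphs_containing F)"
  shows "card (pverts F) \<le> card (vars \<phi>) + sp F + 3"
proof (rule ccontr)
  assume large: "\<not> ?thesis"
  let ?k = "card (vars \<phi>)" and ?p = "sp F + 1"
  obtain N where N: "\<forall>p n. N \<le> p + n \<longrightarrow>
    (\<exists>f. inj_on f (pverts F) \<and> f ` pverts F \<subseteq> {..p + n + ?k} \<and>
      (\<forall>u v. (u, v) \<in> parcs F \<longrightarrow> host_link p n (f u) (f v) \<or> host_link p n (f v) (f u)))"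
    using host_embedding[OF F \<phi>] ..
  \<comment> \<open>The choice \<open>n = N\<close> meets the threshold. The path is so long that a
    sparkler using all of it has tail length \<open>sp F + 1\<close>.\<close>
  obtain f where f: "inj_on f (pverts F)" "f ` pverts F \<subseteq> {..?p + N + ?k}"
    "\<And>u v. (u, v) \<in> parcs F \<Longrightarrow> host_link ?p N (f u) (f v) \<or> host_link ?p N (f v) (f u)"
    using N[rule_format, of ?p N] by auto
  \<comment> \<open>The negated bound gives \<open>card (pverts F) >= ?k + sp F + 4\<close>, so the
    right-hand side is at least \<open>?k + 3\<close>, above the degree bound
    \<open>?k + 1\<close>.\<close>
  have "out_degree (with_proj F) u < card (pverts F) - ?p" for u
    using out_degree_le_card_vars[OF F \<phi>, of u] large by linarith
  then obtain L w where "2 \<le> card L" "sparkler_at F L w ?p"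
    using sparkler_at_of_host_embedding[OF F conn _ f] large by fastforce
  then show False using sparkler_at_le_sp[OF F] by fastforce
qed

theorem lemma8:
  fixes F :: "'a pair_pre_digraph" and l :: nat
  assumes "pair_graph F"
    and "Digraph_Component.connected F"
    and "card (pverts F) = l"
    and "has_pendant_sparkler F"
  shows "int (asymptotic_width F) \<ge> int l - int (sp F) - 3"
proof -
  have "pverts F \<noteq> {}"
    using assms(2) by (simp add: Digraph_Component.connected_def strongly_connected_def)
  then have "\<exists>k \<phi>. sentence \<phi> \<and> defines_asymptotically \<phi> (graphs_containing F) \<and> card (vars \<phi>) = k"
    using sentence_defining_graphs_containing[OF assms(1)] by blast
  \<comment> \<open>The minimum is attained, so a bound for every defining sentence is a bound for
    the width.\<close>
  then have "\<exists>\<phi>. sentence \<phi> \<and> defines_asymptotically \<phi> (graphs_containing F) \<and>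
      card (vars \<phi>) = asymptotic_width F"
    unfolding asymptotic_width_def by (rule LeastI_ex)
  then have "l \<le> asymptotic_width F + sp F + 3"
    using card_vars_ge[OF assms(1,2)] assms(3) by metis
  then show ?thesis by linarith
qed

end
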